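(* Let $X$ be a real normed space and let $K\subset X$ be a convex body. Then $\alpha(K,\mathbf{x})$ grows linearly as $\|\mathbf{x}\|\to\infty$. In particular, $$\lim_{s\to\infty}\frac{\alpha(K,s\mathbf{v})}{s}=\frac{2}{\tau(K,\mathbf{v})}\qquad(\mathbf{v}\in X,\ \|\mathbf{v}\|=1),$$ uniformly for $\mathbf{v}$ in the unit sphere $S$ of $X$, and also $$\frac{2}{d(K)}=\liminf_{\|\mathbf{x}\|\to\infty}\frac{\alpha(K,\mathbf{x})}{\|\mathbf{x}\|}\le\limsup_{\|\mathbf{x}\|\to\infty}\frac{\alpha(K,\mathbf{x})}{\|\mathbf{x}\|}=\frac{2}{w(K)}.$$
   Context: $X$ is a real normed space, $X\neq\{0\}$; $X^*$ is its dual and $S^*$ the unit sphere of $X^*$. A convex body is a bounded, closed, convex set with nonempty interior. For $\mathbf{v}\neq\mathbf{0}$, $\tau(K,\mathbf{v})=\sup\{\lambda\ge0:\exists\,\mathbf{y},\mathbf{z}\in K\text{ with }\mathbf{z}=\mathbf{y}+\lambda\mathbf{v}\}$ is the "maximal chord" of $K$ in direction $\mathbf{v}$. The support function of $K$ is $h(K,\mathbf{v}^* )=\sup_{\mathbf{x}\in K}\langle \mathbf{v}^*,\mathbf{x}\rangle$; $w(K,\mathbf{v}^* )=h(K,\mathbf{v}^* )+h(K,-\mathbf{v}^* )$; the width is $w(K)=\inf_{\mathbf{v}^*\in S^*}w(K,\mathbf{v}^* )$; the diameter is $d(K)=\sup\{\|\mathbf{x}-\mathbf{y}\|:\mathbf{x},\mathbf{y}\in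 K\}$. For $\lambda\ge 0$ and $\mathbf{v}^*\in S^*$, with $r=-h(K,-\mathbf{v}^* )$ and $s=h(K,\mathbf{v}^* )$, set $$L^\lambda(K,\mathbf{v}^* )=\left\{\mathbf{x}\in X:\ \tfrac{\lambda+1}{2}r-\tfrac{\lambda-1}{2}s\le\langle\mathbf{v}^*,\mathbf{x}\rangle\le\tfrac{\lambda+1}{2}s-\tfrac{\lambda-1}{2}r\right\},\qquad K^\lambda=\bigcap_{\mathbf{v}^*\in S^*}L^\lambda(K,\mathbf{v}^* ).$$ The generalized Minkowski functional is $\alpha(K,\mathbf{x})=\inf\{\lambda\ge0:\mathbf{x}\in K^\lambda\}$, which is finite for every $\mathbf{x}\in X$. *)

theory Defs
  imports "HOL-Analysis.Analysis" "HOL-Library.Landau_Symbols"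
begin

(* The dual of the normed space 'a is the type of bounded linear functionals, normed by the
   operator norm, so the dual unit sphere is "sphere 0 1" in that type. All suprema and infima
   below are real-valued; for a convex body in a nonzero space they range over nonempty sets
   bounded on the relevant side (for max_chord: in a nonzero direction). *)

definition convex_body :: "'a::real_normed_vector set \<Rightarrow> bool" where
  "convex_body K \<longleftrightarrow> bounded K \<and> closed K \<and> convex K \<and> interior K \<noteq> {}"

definition max_chord :: "'a::real_normed_vector set \<Rightarrow> 'a \<Rightarrow> real" where
  "max_chord K v = Sup {l. 0 \<le> l \<and> (\<exists>y\<in>K. \<exists>z\<in>K. z = y + l *\<^sub>R v)}"

definition support_fn :: "'a::real_normed_vector set \<Rightarrow> ('a \<Rightarrow>\<^sub>L real) \<Rightarrow> real" where
  "support_fn K f = (SUP x\<in>K. blinfun_apply f x)"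

definition width_dir :: "'a::real_normed_vector set \<Rightarrow> ('a \<Rightarrow>\<^sub>L real) \<Rightarrow> real" where
  "width_dir K f = support_fn K f + support_fn K (- f)"

definition min_width :: "'a::real_normed_vector set \<Rightarrow> real" where
  "min_width K = (INF f\<in>sphere 0 1. width_dir K f)"

definition layer :: "real \<Rightarrow> 'a::real_normed_vector set \<Rightarrow> ('a \<Rightarrow>\<^sub>L real) \<Rightarrow> 'a set" where
  "layer l K f =
     (let r = - support_fn K (- f); s = support_fn K f
      in {x. (l + 1) / 2 * r - (l - 1) / 2 * s \<le> blinfun_apply f x \<and>
             blinfun_apply f x \<le> (l + 1) / 2 * s - (l - 1) / 2 * r})"

definition layer_body :: "real \<Rightarrow> 'a::real_normed_vector set \<Rightarrow> 'a set" where
  "layer_body l K = (\<Inter>f\<in>sphere 0 1. layer l K f)"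

definition gen_minkowski :: "'a::real_normed_vector set \<Rightarrow> 'a \<Rightarrow> real" where
  "gen_minkowski K x = Inf {l. 0 \<le> l \<and> x \<in> layer_body l K}"

end

theory Submission
  imports Defs
begin

text \<open>
  A point \<open>x\<close> lies in the layer \<open>L\<^sup>\<lambda>(K, f)\<close> exactly when
  \<open>\<bar>2 f(x) - (h(K, f) - h(K, -f))\<bar> / w(K, f) \<le> \<lambda>\<close>, so \<open>\<alpha>(K, x)\<close> is the supremum of these
  quotients over the dual unit sphere. For unit functionals the shift \<open>h(K, f) - h(K, -f)\<close> is
  bounded because \<open>K\<close> is bounded, and \<open>w(K, f)\<close> is bounded away from zero because \<open>K\<close> contains
  a ball. Up to an additive constant that depends on \<open>K\<close> alone, \<open>\<alpha>(K, x)\<close> is therefore the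
  positively homogeneous function \<open>sup\<^sub>f 2 \<bar>f(x)\<bar> / w(K, f)\<close>. Dividing by the length of \<open>x\<close>
  turns the constant into a uniformly vanishing error (\<open>gen_minkowski_approx\<close>).

  It remains to see that \<open>sup\<^sub>f \<bar>f(v)\<bar> / w(K, f) = 1 / \<tau>(K, v)\<close>. A chord of \<open>K\<close> of length \<open>l\<close>
  in units of \<open>v\<close> forces \<open>w(K, f) \<ge> l \<bar>f(v)\<bar>\<close>, which is one inequality. For the other, the gauge
  of the difference body \<open>K - K\<close> takes at \<open>v\<close> a value of at least \<open>1 / \<tau>(K, v)\<close>; the Hahn--Banach
  theorem gives a linear functional below the gauge that agrees with it at \<open>v\<close>. Being at most
  \<open>1\<close> on \<open>K - K\<close>, it has width at most \<open>1\<close>, so that its normalization attains the supremum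
  (\<open>width_dir_attains_max_chord\<close>).

  Once \<open>\<alpha>(K, s v) / s = 2 / \<tau>(K, v) + O(1/s)\<close> is known uniformly on the unit sphere, the lower and
  upper limits at infinity are the infimum and supremum of \<open>2 / \<tau>(K, v)\<close> over unit vectors. The
  maximal chords have supremum \<open>d(K)\<close>, directly from the definition, and infimum \<open>w(K)\<close>, since a
  unit functional of small width takes values close to its norm \<open>1\<close> on some unit vector, in whose
  direction all chords must be short.
\<close>

section \<open>Dominated linear functionals\<close>

definition sublinear :: "('a::real_vector \<Rightarrow> real) \<Rightarrow> bool" where
  "sublinear p \<longleftrightarrow> (\<forall>x y. p (x + y) \<le> p x + p y) \<and> (\<forall>c x. c > 0 \<longrightarrow> p (c *\<^sub>R x) = c * p x)"

lemma sublinearI: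
  assumes "\<And>x y. p (x + y) \<le> p x + p y"
    and le: "\<And>c x. c > 0 \<Longrightarrow> p (c *\<^sub>R x) \<le> c * p x"
  shows "sublinear p"
proof -
  have "p (c *\<^sub>R x) = c * p x" if "c > 0" for c x
  proof (rule antisym)
    have "p x \<le> (1 / c) * p (c *\<^sub>R x)"
      using le[of "1 / c" "c *\<^sub>R x"] that by simp
    then show "c * p x \<le> p (c *\<^sub>R x)"
      using that by (simp add: field_simps)
  qed (use le that in auto)
  then show ?thesis
    using assms(1) by (simp add: sublinear_def)
qed

lemma sublinear_add: "sublinear p \<Longrightarrow> p (x + y) \<le> p x + p y"
  and sublinear_scale: "sublinear p \<Longrightarrow> c > 0 \<Longrightarrow> p (c *\<^sub>R x) = c * p x"
  by (auto simp: sublinear_def)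

lemma sublinear_zero: "sublinear p \<Longrightarrow> p 0 = 0"
  using sublinear_scale[of p 2 0] by simp

lemma sublinear_scale_nonneg: "sublinear p \<Longrightarrow> c \<ge> 0 \<Longrightarrow> p (c *\<^sub>R x) = c * p x"
  using sublinear_scale[of p c x] sublinear_zero[of p] by (cases "c = 0") auto

lemma sublinear_neg: "sublinear p \<Longrightarrow> - p (- x) \<le> p x"
  using sublinear_add[of p x "- x"] sublinear_zero[of p] by simp

text \<open>
  For sublinear \<open>p\<close>, the largest sublinear functional below \<open>p\<close> with value at most \<open>- p v\<close> at
  \<open>- v\<close>, and hence linear on the line through \<open>v\<close>. A minimal sublinear functional
  is unchanged by every tilt and hence is linear.
\<close>
definition tilt :: "('a::real_vector \<Rightarrow> real) \<Rightarrow> 'a \<Rightarrow> 'a \<Rightarrow> real" where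
  "tilt p v x = (INF t\<in>{0..}. p (x + t *\<^sub>R v) - t * p v)"

lemma tilt_le:
  assumes "sublinear p" and "t \<ge> 0"
  shows "tilt p v x \<le> p (x + t *\<^sub>R v) - t * p v"
proof -
  have "- p (- x) \<le> p (x + s *\<^sub>R v) - s * p v" if "s \<ge> 0" for s
    using sublinear_add[OF assms(1), of "x + s *\<^sub>R v" "- x"]
      sublinear_scale_nonneg[OF assms(1) that, of v] by simp
  then have "bdd_below ((\<lambda>s. p (x + s *\<^sub>R v) - s * p v) ` {0..})"
    by (intro bdd_belowI2[where m = "- p (- x)"]) auto
  then show ?thesis
    unfolding tilt_def using assms(2) by (intro cINF_lower) auto
qed

lemma tilt_greatest:
  assumes "\<And>t. t \<ge> 0 \<Longrightarrow> b \<le> p (x + t *\<^sub>R v) - t * p v"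
  shows "b \<le> tilt p v x"
  unfolding tilt_def using assms by (intro cINF_greatest) auto

lemma sublinear_tilt:
  assumes p: "sublinear p"
  shows "sublinear (tilt p v)"
proof (rule sublinearI)
  fix x y
  have *: "tilt p v (x + y) \<le> (p (x + t *\<^sub>R v) - t * p v) + (p (y + s *\<^sub>R v) - s * p v)"
    if "t \<ge> 0" "s \<ge> 0" for t s
    using tilt_le[OF p, of "t + s" v "x + y"]
      sublinear_add[OF p, of "x + t *\<^sub>R v" "y + s *\<^sub>R v"] that
    by (simp add: algebra_simps)
  have "tilt p v (x + y) - (p (x + t *\<^sub>R v) - t * p v) \<le> tilt p v y" if "t \<ge> 0" for t
    using *[OF that] by (intro tilt_greatest) (simp add: algebra_simps)
  then have "tilt p v (x + y) - tilt p v y \<le> tilt p v x"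
    by (intro tilt_greatest) (simp add: algebra_simps)
  then show "tilt p v (x + y) \<le> tilt p v x + tilt p v y"
    by simp
next
  fix c :: real and x :: 'a
  assume c: "c > 0"
  have "tilt p v (c *\<^sub>R x) / c \<le> tilt p v x"
  proof (rule tilt_greatest)
    fix t :: real
    assume "t \<ge> 0"
    then have "tilt p v (c *\<^sub>R x) \<le> p (c *\<^sub>R (x + t *\<^sub>R v)) - c * t * p v"
      using tilt_le[OF p, of "c * t" v "c *\<^sub>R x"] c by (simp add: algebra_simps)
    also have "\<dots> = c * (p (x + t *\<^sub>R v) - t * p v)"
      unfolding sublinear_scale[OF p c] by (simp add: algebra_simps)
    finally show "tilt p v (c *\<^sub>R x) / c \<le> p (x + t *\<^sub>R v) - t * p v"
      using c by (simp add: field_simps)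
  qed
  then show "tilt p v (c *\<^sub>R x) \<le> c * tilt p v x"
    using c by (simp add: field_simps)
qed

text \<open>
  The bound \<open>- p (- x) \<le> q x\<close>, common to all sublinear \<open>q \<le> p\<close>, keeps the pointwise infimum
  finite; comparability within the chain gives its subadditivity.
\<close>
lemma sublinear_chain_Inf:
  assumes sub: "\<And>q. q \<in> C \<Longrightarrow> sublinear q"
    and dom: "\<And>q x. q \<in> C \<Longrightarrow> q x \<le> p x"
    and chain: "\<And>q r. q \<in> C \<Longrightarrow> r \<in> C \<Longrightarrow> q \<le> r \<or> r \<le> q"
    and ne: "C \<noteq> {}"
  shows "sublinear (\<lambda>x. INF q\<in>C. q x)" and "\<And>q x. q \<in> C \<Longrightarrow> (INF q\<in>C. q x) \<le> q x"
proof -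
  have "- p (- x) \<le> q x" if "q \<in> C" for q x
    using sublinear_neg[OF sub[OF that], of x] dom[OF that, of "- x"] by linarith
  then have bdd: "bdd_below ((\<lambda>q. q x) ` C)" for x
    by (intro bdd_belowI2[where m = "- p (- x)"])
  show lower: "(INF q\<in>C. q x) \<le> q x" if "q \<in> C" for q x
    using bdd that by (intro cINF_lower) auto
  show "sublinear (\<lambda>x. INF q\<in>C. q x)"
  proof (rule sublinearI)
    fix x y
    have *: "(INF q\<in>C. q (x + y)) \<le> q x + r y" if qr: "q \<in> C" "r \<in> C" for q r
      \<comment> \<open>The smaller of \<open>q\<close> and \<open>r\<close> is dominated by both.\<close>
      using chain[OF qr]
    proof
      assume "q \<le> r"
      then show ?thesis
        using lower[OF qr(1), of "x + y"] sublinear_add[OF sub[OF qr(1)], of x y]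
        by (auto simp: le_fun_def intro: order_trans add_left_mono)
    next
      assume "r \<le> q"
      then show ?thesis
        using lower[OF qr(2), of "x + y"] sublinear_add[OF sub[OF qr(2)], of x y]
        by (auto simp: le_fun_def intro: order_trans add_right_mono)
    qed
    have "(INF q\<in>C. q (x + y)) - q x \<le> (INF r\<in>C. r y)" if "q \<in> C" for q
      using *[OF that] by (intro cINF_greatest[OF ne]) (simp add: algebra_simps)
    then have "(INF q\<in>C. q (x + y)) - (INF r\<in>C. r y) \<le> (INF q\<in>C. q x)"
      by (intro cINF_greatest[OF ne]) (simp add: algebra_simps)
    then show "(INF q\<in>C. q (x + y)) \<le> (INF q\<in>C. q x) + (INF q\<in>C. q y)"
      by simp
  next
    fix c :: real and x :: 'a
    assume c: "c > 0"
    have "(INF q\<in>C. q (c *\<^sub>R x)) / c \<le> (INF q\<in>C. q x)"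
    proof (rule cINF_greatest[OF ne])
      fix q
      assume q: "q \<in> C"
      show "(INF q\<in>C. q (c *\<^sub>R x)) / c \<le> q x"
        using lower[OF q, of "c *\<^sub>R x"] sublinear_scale[OF sub[OF q] c] c
        by (simp add: field_simps)
    qed
    then show "(INF q\<in>C. q (c *\<^sub>R x)) \<le> c * (INF q\<in>C. q x)"
      using c by (simp add: field_simps)
  qed
qed

lemma minimal_sublinear_exists:
  assumes p: "sublinear p"
  obtains q where "sublinear q" "q \<le> p" "\<And>r. sublinear r \<Longrightarrow> r \<le> q \<Longrightarrow> r = q"
proof -
  define A where "A = {q. sublinear q \<and> q \<le> p}"
  have "\<exists>m\<in>A. \<forall>a\<in>A. a \<le> m \<longrightarrow> a = m"
  proof (rule predicate_Zorn[of A "\<lambda>a b. b \<le> a"])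
    show "partial_order_on A (relation_of (\<lambda>a b. b \<le> a) A)"
      by (rule partial_order_on_relation_ofI) auto
  next
    fix C
    assume C: "C \<in> Chains (relation_of (\<lambda>a b. b \<le> a) A)"
    then have CA: "q \<in> A" if "q \<in> C" for q
      using that by (auto simp: Chains_def relation_of_def)
    have chain: "q \<le> r \<or> r \<le> q" if "q \<in> C" "r \<in> C" for q r
      using that C by (auto simp: Chains_def relation_of_def)
    show "\<exists>u\<in>A. \<forall>a\<in>C. u \<le> a"
    proof (cases "C = {}")
      case True
      then show ?thesis using p by (auto simp: A_def)
    next
      case False
      let ?u = "\<lambda>x. INF q\<in>C. q x"
      have sub: "sublinear q" and dom: "q x \<le> p x" if "q \<in> C" for q x
        using CA[OF that] by (auto simp: A_def le_fun_def)
      have inf: "sublinear ?u" "\<And>q x. q \<in> C \<Longrightarrow> ?u x \<le> q x"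
        by (rule sublinear_chain_Inf[where C = C and p = p]; use sub dom chain False in blast)+
      have le: "?u \<le> q" if "q \<in> C" for q
        using inf(2)[OF that] by (auto simp: le_fun_def)
      obtain q where "q \<in> C" using False by auto
      then have "?u \<le> p"
        using le[of q] dom[of q] by (auto simp: le_fun_def intro: order_trans)
      then show ?thesis
        using inf(1) le by (intro bexI[of _ ?u]) (auto simp: A_def)
    qed
  qed
  then show ?thesis
    using that by (auto simp: A_def)
qed

text \<open>
  The Hahn--Banach theorem without extending functionals from subspaces: a minimal sublinear
  functional below \<open>tilt p v\<close> is linear, and the tilt already forces equality with \<open>p\<close> at \<open>v\<close>.
\<close>
theorem hahn_banach_dominated:
  assumes p: "sublinear p"
  obtains f where "linear f" "\<And>x. f x \<le> p x" "f v = p v"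
proof -
  obtain f where f: "sublinear f" and le: "f \<le> tilt p v"
    and minimal: "\<And>r. sublinear r \<Longrightarrow> r \<le> f \<Longrightarrow> r = f"
    using minimal_sublinear_exists[OF sublinear_tilt[OF p]] by metis
  have neg: "f (- x) = - f x" for x
  proof -
    \<comment> \<open>By minimality, tilting in the direction of \<open>x\<close> changes nothing.\<close>
    have "tilt f x \<le> f"
      using tilt_le[OF f, of 0 x] by (auto simp: le_fun_def)
    then have "f (- x) = tilt f x (- x)"
      using minimal[OF sublinear_tilt[OF f]] by metis
    also have "\<dots> \<le> - f x"
      using tilt_le[OF f, of 1 x "- x"] sublinear_zero[OF f] by simp
    finally show ?thesis
      using sublinear_neg[OF f, of x] by linarith
  qed
  have "linear f"
  proof
    fix x y
    show "f (x + y) = f x + f y"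
      using sublinear_add[OF f, of x y] sublinear_add[OF f, of "- x" "- y"] neg[of "x + y"]
      by (simp add: neg)
  next
    fix c :: real and x
    show "f (c *\<^sub>R x) = c *\<^sub>R f x"
      using sublinear_scale_nonneg[OF f, of c x] sublinear_scale_nonneg[OF f, of "- c" x]
      by (cases "c \<ge> 0") (auto simp: neg)
  qed
  moreover have dom: "f x \<le> p x" for x
    using le_funD[OF le, of x] tilt_le[OF p, of 0 v x] by simp
  moreover have "f v = p v"
    using le_funD[OF le, of "- v"] tilt_le[OF p, of 1 v "- v"] sublinear_zero[OF p] dom[of v]
    by (simp add: neg)
  ultimately show ?thesis
    using that by blast
qed

section \<open>Support functions and widths\<close>

lemma convex_body_cball:
  assumes "convex_body K"
  obtains c \<rho> where "\<rho> > 0" "cball c \<rho> \<subseteq> K"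
  using assms by (auto simp: convex_body_def mem_interior_cball)

lemma convex_body_nonempty: "convex_body K \<Longrightarrow> K \<noteq> {}"
  by (auto simp: convex_body_def)

lemma bdd_above_blinfun_image:
  fixes f :: "'a::real_normed_vector \<Rightarrow>\<^sub>L real"
  assumes "bounded K"
  shows "bdd_above (blinfun_apply f ` K)"
  using assms by (intro bounded_imp_bdd_above bounded_linear_image blinfun.bounded_linear_right)

lemma support_fn_upper:
  fixes f :: "'a::real_normed_vector \<Rightarrow>\<^sub>L real"
  assumes "convex_body K" "x \<in> K"
  shows "f x \<le> support_fn K f"
  using assms unfolding support_fn_def convex_body_def
  by (intro cSUP_upper bdd_above_blinfun_image) auto

lemma support_fn_least:
  fixes f :: "'a::real_normed_vector \<Rightarrow>\<^sub>L real"
  assumes "convex_body K" "\<And>x. x \<in> K \<Longrightarrow> f x \<le> b"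
  shows "support_fn K f \<le> b"
  unfolding support_fn_def using convex_body_nonempty assms by (intro cSUP_least) auto

lemma diff_le_width_dir:
  fixes f :: "'a::real_normed_vector \<Rightarrow>\<^sub>L real"
  assumes "convex_body K" "y \<in> K" "z \<in> K"
  shows "f z - f y \<le> width_dir K f"
  using support_fn_upper[OF assms(1,3), of f] support_fn_upper[OF assms(1,2), of "- f"]
  by (simp add: width_dir_def blinfun.minus_left)

lemma width_dir_least:
  fixes f :: "'a::real_normed_vector \<Rightarrow>\<^sub>L real"
  assumes K: "convex_body K" and le: "\<And>y z. y \<in> K \<Longrightarrow> z \<in> K \<Longrightarrow> f z - f y \<le> b"
  shows "width_dir K f \<le> b"
proof -
  have "support_fn K f \<le> b - support_fn K (- f)"
  proof (rule support_fn_least[OF K])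
    fix z
    assume z: "z \<in> K"
    have "support_fn K (- f) \<le> b - f z"
      using le[OF _ z] by (intro support_fn_least[OF K]) (simp add: blinfun.minus_left algebra_simps)
    then show "f z \<le> b - support_fn K (- f)"
      by simp
  qed
  then show ?thesis
    by (simp add: width_dir_def)
qed

text \<open>
  The ball in \<open>K\<close> contributes its diameter in every direction. This bound is what makes the
  quotients by \<open>width_dir K f\<close> harmless, uniformly over the dual sphere.
\<close>
lemma norm_le_width_dir:
  fixes f :: "'a::real_normed_vector \<Rightarrow>\<^sub>L real"
  assumes K: "convex_body K" and \<rho>: "\<rho> > 0" and sub: "cball c \<rho> \<subseteq> K"
  shows "2 * \<rho> * norm f \<le> width_dir K f"
proof -
  have pos: "2 * \<rho> * f x \<le> width_dir K f * norm x" for x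
  proof (cases "x = 0")
    case False
    let ?u = "(\<rho> / norm x) *\<^sub>R x"
    have "c + ?u \<in> K" "c - ?u \<in> K"
      using sub \<rho> False by (auto simp: subset_iff dist_norm)
    from diff_le_width_dir[OF K this(2,1), of f]
    show ?thesis
      using False by (simp add: blinfun.add_right blinfun.diff_right blinfun.scaleR_right field_simps)
  qed simp
  have abs: "norm (f x) \<le> width_dir K f / (2 * \<rho>) * norm x" for x
    using pos[of x] pos[of "- x"] \<rho> by (simp add: blinfun.minus_right field_simps abs_if)
  obtain y where "y \<in> K" using convex_body_nonempty[OF K] by auto
  then have "0 \<le> width_dir K f"
    using diff_le_width_dir[OF K, of y y f] by simp
  then have "norm f \<le> width_dir K f / (2 * \<rho>)"
    using \<rho> abs by (intro norm_blinfun_bound) auto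
  then show ?thesis
    using \<rho> by (simp add: field_simps)
qed

lemma width_dir_pos:
  assumes "convex_body K" "f \<in> sphere 0 1"
  shows "width_dir K f > 0"
proof -
  obtain c \<rho> where "\<rho> > 0" "cball c \<rho> \<subseteq> K" using convex_body_cball[OF assms(1)] .
  with norm_le_width_dir[OF assms(1) this, of f] assms(2) show ?thesis by auto
qed

section \<open>Chords and widths\<close>

text \<open>
  The Minkowski gauge of the difference body \<open>K - K\<close>. Its reciprocal in direction \<open>v\<close> is the
  maximal chord of \<open>K\<close>.
\<close>
definition difference_gauge :: "'a::real_vector set \<Rightarrow> 'a \<Rightarrow> real" where
  "difference_gauge K x = Inf {t. t > 0 \<and> (\<exists>y\<in>K. \<exists>z\<in>K. x = t *\<^sub>R (z - y))}"

lemma difference_gauge_le: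
  assumes "t > 0" "y \<in> K" "z \<in> K"
  shows "difference_gauge K (t *\<^sub>R (z - y)) \<le> t"
  unfolding difference_gauge_def using assms
  by (intro cInf_lower) (auto intro!: bdd_belowI[of _ 0])

lemma absorbing_differences:
  assumes \<rho>: "\<rho> > 0" and sub: "cball c \<rho> \<subseteq> K" and "norm x \<le> \<rho> * t" and t: "t > 0"
  shows "\<exists>y\<in>K. \<exists>z\<in>K. x = t *\<^sub>R (z - y)"
proof (intro bexI)
  show "x = t *\<^sub>R ((c + (1 / t) *\<^sub>R x) - c)" using t by simp
  show "c \<in> K" using sub \<rho> by auto
  have "norm ((1 / t) *\<^sub>R x) \<le> \<rho>" using assms by (simp add: field_simps)
  then show "c + (1 / t) *\<^sub>R x \<in> K" using sub by (auto simp: subset_iff dist_norm)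
qed

lemma difference_gauge_greatest:
  assumes K: "convex_body K"
    and le: "\<And>t y z. t > 0 \<Longrightarrow> y \<in> K \<Longrightarrow> z \<in> K \<Longrightarrow> x = t *\<^sub>R (z - y) \<Longrightarrow> b \<le> t"
  shows "b \<le> difference_gauge K x"
proof -
  obtain c \<rho> where \<rho>: "\<rho> > 0" "cball c \<rho> \<subseteq> K" using convex_body_cball[OF K] .
  define t where "t = (norm x + 1) / \<rho>"
  have "t > 0" "norm x \<le> \<rho> * t"
    using \<rho> by (auto simp: t_def intro!: divide_pos_pos add_nonneg_pos)
  then show ?thesis
    unfolding difference_gauge_def using absorbing_differences[OF \<rho>, of x t] le
    by (intro cInf_greatest) blast+
qed

text \<open>
  Subadditivity comes from convexity of \<open>K\<close>: \<open>t (b - a) + s (b' - a')\<close> is \<open>t + s\<close> times the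
  difference of the two convex combinations with weights \<open>t / (t + s)\<close> and \<open>s / (t + s)\<close>.
\<close>
lemma sublinear_difference_gauge:
  fixes K :: "'a::real_normed_vector set"
  assumes K: "convex_body K"
  shows "sublinear (difference_gauge K)"
proof (rule sublinearI)
  fix x y
  have cv: "convex K" using K by (simp add: convex_body_def)
  have *: "difference_gauge K (x + y) \<le> t + s"
    if t: "t > 0" "a \<in> K" "b \<in> K" "x = t *\<^sub>R (b - a)"
      and s: "s > 0" "a' \<in> K" "b' \<in> K" "y = s *\<^sub>R (b' - a')" for t s a b a' b'
  proof -
    let ?m = "\<lambda>u u'. (t / (t + s)) *\<^sub>R u + (s / (t + s)) *\<^sub>R u'"
    have mem: "?m u u' \<in> K" if "u \<in> K" "u' \<in> K" for u u'
      using t(1) s(1) that by (intro convexD[OF cv]) (auto simp flip: add_divide_distrib)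
    have scaled: "(t + s) *\<^sub>R ?m u u' = t *\<^sub>R u + s *\<^sub>R u'" for u u' :: 'a
      using t(1) s(1) by (simp add: scaleR_right_distrib)
    have "x + y = (t + s) *\<^sub>R (?m b b' - ?m a a')"
      unfolding t(4) s(4) scaleR_right_diff_distrib[of "t + s"] scaled
      by (simp add: scaleR_right_diff_distrib)
    moreover have "difference_gauge K ((t + s) *\<^sub>R (?m b b' - ?m a a')) \<le> t + s"
      using t(1) s(1) by (intro difference_gauge_le mem t(2,3) s(2,3)) simp
    ultimately show ?thesis by (simp only:)
  qed
  have outer: "difference_gauge K (x + y) - t \<le> difference_gauge K y"
    if "t > 0" "a \<in> K" "b \<in> K" "x = t *\<^sub>R (b - a)" for t a b
  proof (rule difference_gauge_greatest[OF K])
    fix s a' b'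
    assume "s > 0" "a' \<in> K" "b' \<in> K" "y = s *\<^sub>R (b' - a')"
    from *[OF that this] show "difference_gauge K (x + y) - t \<le> s" by linarith
  qed
  have "difference_gauge K (x + y) - difference_gauge K y \<le> difference_gauge K x"
  proof (rule difference_gauge_greatest[OF K])
    fix t a b
    assume "t > 0" "a \<in> K" "b \<in> K" "x = t *\<^sub>R (b - a)"
    from outer[OF this] show "difference_gauge K (x + y) - difference_gauge K y \<le> t"
      by linarith
  qed
  then show "difference_gauge K (x + y) \<le> difference_gauge K x + difference_gauge K y"
    by simp
next
  fix c :: real and x :: 'a
  assume c: "c > 0"
  have "difference_gauge K (c *\<^sub>R x) / c \<le> difference_gauge K x"
  proof (rule difference_gauge_greatest[OF K])
    fix t y z
    assume t: "t > 0" "y \<in> K" "z \<in> K" "x = t *\<^sub>R (z - y)"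
    have "difference_gauge K ((c * t) *\<^sub>R (z - y)) \<le> c * t"
      using t(1-3) c by (intro difference_gauge_le) auto
    then show "difference_gauge K (c *\<^sub>R x) / c \<le> t"
      using c by (simp add: t(4) pos_divide_le_eq mult.commute[of t])
  qed
  then show "difference_gauge K (c *\<^sub>R x) \<le> c * difference_gauge K x"
    using c by (simp add: field_simps)
qed

lemma chord_le_diameter:
  assumes "convex_body K" "y \<in> K" "y + l *\<^sub>R v \<in> K" "0 \<le> l"
  shows "l * norm v \<le> diameter K"
  using diameter_bounded_bound[of K "y + l *\<^sub>R v" y] assms
  by (simp add: convex_body_def dist_norm)

lemma chord_le_max_chord:
  assumes K: "convex_body K" and v: "v \<noteq> 0" and "y \<in> K" "y + l *\<^sub>R v \<in> K" "0 \<le> l"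
  shows "l \<le> max_chord K v"
  unfolding max_chord_def
proof (rule cSup_upper)
  show "bdd_above {l. 0 \<le> l \<and> (\<exists>y\<in>K. \<exists>z\<in>K. z = y + l *\<^sub>R v)}"
    using chord_le_diameter[OF K] v
    by (intro bdd_aboveI[of _ "diameter K / norm v"]) (auto simp: field_simps)
qed (use assms in auto)

lemma max_chord_least:
  assumes "convex_body K" and "\<And>y l. y \<in> K \<Longrightarrow> y + l *\<^sub>R v \<in> K \<Longrightarrow> 0 \<le> l \<Longrightarrow> l \<le> b"
  shows "max_chord K v \<le> b"
  unfolding max_chord_def
proof (rule cSup_least)
  obtain y where "y \<in> K" using convex_body_nonempty[OF assms(1)] by auto
  then have "0 \<in> {l. 0 \<le> l \<and> (\<exists>y\<in>K. \<exists>z\<in>K. z = y + l *\<^sub>R v)}" by auto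
  then show "{l. 0 \<le> l \<and> (\<exists>y\<in>K. \<exists>z\<in>K. z = y + l *\<^sub>R v)} \<noteq> {}" by blast
qed (use assms in auto)

lemma max_chord_pos:
  assumes K: "convex_body K" and v: "v \<noteq> 0"
  shows "max_chord K v > 0"
proof -
  obtain c \<rho> where \<rho>: "\<rho> > 0" "cball c \<rho> \<subseteq> K" using convex_body_cball[OF K] .
  have "c \<in> K" "c + (\<rho> / norm v) *\<^sub>R v \<in> K"
    using \<rho> v by (auto simp: subset_iff dist_norm)
  then have "\<rho> / norm v \<le> max_chord K v"
    using \<rho> by (intro chord_le_max_chord[OF K v]) auto
  moreover have "\<rho> / norm v > 0" using \<rho> v by simp
  ultimately show ?thesis by linarith
qed

text \<open>
  A functional sees every chord: its end points have values differing by \<open>l * f v\<close>, which is at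
  most the width.
\<close>
lemma max_chord_mult_le_width_dir:
  fixes f :: "'a::real_normed_vector \<Rightarrow>\<^sub>L real"
  assumes K: "convex_body K" and v: "v \<noteq> 0"
  shows "max_chord K v * \<bar>f v\<bar> \<le> width_dir K f"
proof -
  have chord: "l * \<bar>f v\<bar> \<le> width_dir K f" if "y \<in> K" "y + l *\<^sub>R v \<in> K" "0 \<le> l" for y l
    using diff_le_width_dir[OF K that(1,2), of f] diff_le_width_dir[OF K that(2,1), of f] that(3)
    by (simp add: blinfun.add_right blinfun.scaleR_right abs_if)
  show ?thesis
  proof (cases "f v = 0")
    case True
    obtain y where "y \<in> K" using convex_body_nonempty[OF K] by auto
    then show ?thesis using diff_le_width_dir[OF K, of y y f] True by simp
  next
    case False
    then have "max_chord K v \<le> width_dir K f / \<bar>f v\<bar>"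
      using chord by (intro max_chord_least[OF K]) (auto simp: field_simps)
    then show ?thesis using False by (simp add: field_simps)
  qed
qed

text \<open>
  The converse estimate, for one functional: apply the Hahn--Banach theorem to the gauge of
  \<open>K - K\<close> at \<open>v\<close>. The ball in \<open>K\<close> makes the gauge, and with it the functional, bounded by a
  multiple of the norm; the gauge is at most \<open>1\<close> on differences of points of \<open>K\<close>, so the width of
  the functional is at most \<open>1\<close>.
\<close>
lemma width_dir_attains_max_chord:
  fixes v :: "'a::real_normed_vector"
  assumes K: "convex_body K" and v: "v \<noteq> 0"
  obtains f :: "'a \<Rightarrow>\<^sub>L real"
  where "f \<in> sphere 0 1" "width_dir K f \<le> max_chord K v * \<bar>f v\<bar>"
proof -
  let ?p = "difference_gauge K"
  obtain c \<rho> where \<rho>: "\<rho> > 0" "cball c \<rho> \<subseteq> K" using convex_body_cball[OF K] .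
  obtain g where g: "linear g" and dom: "\<And>x. g x \<le> ?p x" and gv: "g v = ?p v"
    using hahn_banach_dominated[OF sublinear_difference_gauge[OF K]] by metis
  have bound: "g x \<le> norm x * (1 / \<rho>)" for x
  proof (cases "x = 0")
    case True
    then show ?thesis using linear_0[OF g] by simp
  next
    case False
    let ?t = "norm x * (1 / \<rho>)"
    have t: "?t > 0" "norm x \<le> \<rho> * ?t" using \<rho> False by auto
    obtain y z where "y \<in> K" "z \<in> K" "x = ?t *\<^sub>R (z - y)"
      using absorbing_differences[OF \<rho> t(2,1)] by blast
    then have "?p x \<le> ?t" using difference_gauge_le[OF t(1)] by metis
    with dom[of x] show ?thesis by linarith
  qed
  have "bounded_linear g"
  proof (rule bounded_linear_intro[where K = "1 / \<rho>"])
    fix x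
    show "norm (g x) \<le> norm x * (1 / \<rho>)"
      using bound[of x] bound[of "- x"] linear_neg[OF g, of x] by (auto simp: abs_if)
  qed (use g in \<open>auto simp: linear_add linear_scale\<close>)
  then have app: "blinfun_apply (Blinfun g) = g" by (rule bounded_linear_Blinfun_apply)
  have diff: "g z - g y \<le> 1" if "y \<in> K" "z \<in> K" for y z
    using dom[of "z - y"] difference_gauge_le[of 1 y K z] that linear_diff[OF g, of z y] by simp
  have "1 / max_chord K v \<le> g v"
    unfolding gv
  proof (rule difference_gauge_greatest[OF K])
    fix t y z
    assume t: "t > 0" "y \<in> K" "z \<in> K" "v = t *\<^sub>R (z - y)"
    then have "y + (1 / t) *\<^sub>R v = z" by simp
    then have "1 / t \<le> max_chord K v"
      using t(1-3) by (intro chord_le_max_chord[OF K v, of y]) auto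
    then show "1 / max_chord K v \<le> t"
      using t(1) max_chord_pos[OF K v] by (simp add: field_simps)
  qed
  then have gv1: "1 \<le> max_chord K v * g v"
    using max_chord_pos[OF K v] by (simp add: field_simps)
  then have gpos: "g v > 0"
    using max_chord_pos[OF K v] by (smt (verit) mult_nonneg_nonpos)
  define n where "n = norm (Blinfun g)"
  have "Blinfun g \<noteq> 0" using gpos app by (metis blinfun.zero_left less_irrefl)
  then have n: "n > 0" by (simp add: n_def)
  define f where "f = (1 / n) *\<^sub>R Blinfun g"
  have fa: "f x = g x / n" for x by (simp add: f_def blinfun.scaleR_left app)
  show ?thesis
  proof
    show "f \<in> sphere 0 1" using n by (simp add: f_def) (simp add: n_def)
    have "width_dir K f \<le> 1 / n"
      using diff n
      by (intro width_dir_least[OF K]) (auto simp: fa intro!: divide_right_mono simp flip: diff_divide_distrib)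
    also have "\<dots> \<le> max_chord K v * g v / n"
      using gv1 n by (intro divide_right_mono) auto
    also have "\<dots> = max_chord K v * \<bar>f v\<bar>"
      using gpos n by (simp add: fa)
    finally show "width_dir K f \<le> max_chord K v * \<bar>f v\<bar>" .
  qed
qed

text \<open>
  Needed so that the infimum over the dual sphere in \<open>min_width\<close> is a genuine one.
\<close>
lemma dual_sphere_nonempty:
  fixes K :: "'a::real_normed_vector set"
  assumes "convex_body K" "v \<noteq> (0::'a)"
  shows "sphere (0 :: 'a \<Rightarrow>\<^sub>L real) 1 \<noteq> {}"
proof -
  obtain f :: "'a \<Rightarrow>\<^sub>L real" where "f \<in> sphere 0 1"
    using width_dir_attains_max_chord[OF assms] .
  then show ?thesis by blast
qed

lemma width_ratio_le:
  fixes f :: "'a::real_normed_vector \<Rightarrow>\<^sub>L real"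
  assumes K: "convex_body K" and v: "v \<noteq> 0" and f: "f \<in> sphere 0 1"
  shows "2 * \<bar>f v\<bar> / width_dir K f \<le> 2 / max_chord K v"
  using max_chord_mult_le_width_dir[OF K v, of f] width_dir_pos[OF K f] max_chord_pos[OF K v]
  by (simp add: field_simps)

lemma width_ratio_attained:
  fixes v :: "'a::real_normed_vector"
  assumes K: "convex_body K" and v: "v \<noteq> 0"
  obtains f :: "'a \<Rightarrow>\<^sub>L real"
  where "f \<in> sphere 0 1" "2 * \<bar>f v\<bar> / width_dir K f = 2 / max_chord K v"
proof -
  obtain f :: "'a \<Rightarrow>\<^sub>L real"
    where f: "f \<in> sphere 0 1" "width_dir K f \<le> max_chord K v * \<bar>f v\<bar>"
    using width_dir_attains_max_chord[OF K v] .
  have "2 / max_chord K v \<le> 2 * \<bar>f v\<bar> / width_dir K f"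
    using f(2) width_dir_pos[OF K f(1)] max_chord_pos[OF K v] by (simp add: field_simps)
  with that[OF f(1)] width_ratio_le[OF K v f(1)] show ?thesis by simp
qed

section \<open>The generalized Minkowski functional\<close>

text \<open>
  The least dilation factor for which the dilated layer orthogonal to \<open>f\<close> contains \<open>x\<close>: the
  distance of \<open>f x\<close> from the centre of the layer, relative to half of its width.
\<close>
definition layer_ratio :: "'a::real_normed_vector set \<Rightarrow> ('a \<Rightarrow>\<^sub>L real) \<Rightarrow> 'a \<Rightarrow> real" where
  "layer_ratio K f x =
     \<bar>2 * blinfun_apply f x - (support_fn K f - support_fn K (- f))\<bar> / width_dir K f"

lemma mem_layer_iff:
  assumes "convex_body K" "f \<in> sphere 0 1"
  shows "x \<in> layer l K f \<longleftrightarrow> layer_ratio K f x \<le> l"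
proof -
  have "layer_ratio K f x \<le> l \<longleftrightarrow>
      \<bar>2 * blinfun_apply f x - (support_fn K f - support_fn K (- f))\<bar> \<le> l * width_dir K f"
    using width_dir_pos[OF assms] by (simp add: layer_ratio_def pos_divide_le_eq)
  also have "\<dots> \<longleftrightarrow> x \<in> layer l K f"
    unfolding abs_le_iff by (auto simp: layer_def width_dir_def Let_def field_simps)
  finally show ?thesis by simp
qed

lemma layer_ratio_approx:
  fixes K :: "'a::real_normed_vector set"
  assumes K: "convex_body K"
  obtains C where "C \<ge> 0" and
    "\<And>f x. f \<in> sphere 0 1 \<Longrightarrow> \<bar>layer_ratio K f x - 2 * \<bar>blinfun_apply f x\<bar> / width_dir K f\<bar> \<le> C"
proof -
  obtain c \<rho> where \<rho>: "\<rho> > 0" "cball c \<rho> \<subseteq> K" using convex_body_cball[OF K] .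
  obtain R where R: "\<And>x. x \<in> K \<Longrightarrow> norm x \<le> R"
    using K by (auto simp: convex_body_def bounded_iff)
  obtain y where y: "y \<in> K" using convex_body_nonempty[OF K] by auto
  have R0: "R \<ge> 0" using R[OF y] norm_ge_zero[of y] by linarith
  show ?thesis
  proof
    show "R / \<rho> \<ge> 0" using R0 \<rho> by simp
  next
    fix f :: "'a \<Rightarrow>\<^sub>L real" and x
    assume f: "f \<in> sphere 0 1"
    let ?m = "support_fn K f - support_fn K (- f)" and ?w = "width_dir K f"
    have w: "2 * \<rho> \<le> ?w" using norm_le_width_dir[OF K \<rho>, of f] f by simp
    have fR: "\<bar>f z\<bar> \<le> R" if "z \<in> K" for z
      using norm_blinfun[of f z] R[OF that] f by simp
    have "support_fn K f \<le> R" "support_fn K (- f) \<le> R"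
      using fR by (force intro!: support_fn_least[OF K] simp: blinfun.minus_left abs_le_iff)+
    moreover have "- R \<le> support_fn K f" "- R \<le> support_fn K (- f)"
      using fR[OF y] support_fn_upper[OF K y, of f] support_fn_upper[OF K y, of "- f"]
      by (auto simp: blinfun.minus_left)
    ultimately have m: "\<bar>?m\<bar> \<le> 2 * R" by linarith
    have "\<bar>layer_ratio K f x - 2 * \<bar>blinfun_apply f x\<bar> / ?w\<bar>
        = \<bar>\<bar>2 * blinfun_apply f x - ?m\<bar> - \<bar>2 * blinfun_apply f x\<bar>\<bar> / ?w"
      using w \<rho>(1) by (simp add: layer_ratio_def abs_mult flip: diff_divide_distrib)
    also have "\<dots> \<le> (2 * R) / (2 * \<rho>)"
      using m w \<rho>(1) by (intro frac_le) auto
    finally show "\<bar>layer_ratio K f x - 2 * \<bar>blinfun_apply f x\<bar> / ?w\<bar> \<le> R / \<rho>"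
      by simp
  qed
qed

lemma gen_minkowski_least:
  assumes "convex_body K" "0 \<le> b" "\<And>f. f \<in> sphere 0 1 \<Longrightarrow> layer_ratio K f x \<le> b"
  shows "gen_minkowski K x \<le> b"
  unfolding gen_minkowski_def
proof (rule cInf_lower)
  show "b \<in> {l. 0 \<le> l \<and> x \<in> layer_body l K}"
    using assms by (simp add: layer_body_def mem_layer_iff)
qed (auto intro: bdd_belowI[of _ 0])

text \<open>
  The common bound \<open>b\<close> shows that some layer body contains \<open>x\<close>, so the infimum defining
  \<open>gen_minkowski\<close> is over a nonempty set.
\<close>
lemma layer_ratio_le_gen_minkowski:
  assumes K: "convex_body K" and f: "f \<in> sphere 0 1"
    and bounded: "0 \<le> b" "\<And>g. g \<in> sphere 0 1 \<Longrightarrow> layer_ratio K g x \<le> b"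
  shows "layer_ratio K f x \<le> gen_minkowski K x"
  unfolding gen_minkowski_def
proof (rule cInf_greatest)
  have "b \<in> {l. 0 \<le> l \<and> x \<in> layer_body l K}"
    using bounded K by (simp add: layer_body_def mem_layer_iff)
  then show "{l. 0 \<le> l \<and> x \<in> layer_body l K} \<noteq> {}" by blast
next
  fix l
  assume "l \<in> {l. 0 \<le> l \<and> x \<in> layer_body l K}"
  then have "x \<in> layer l K f" using f by (auto simp: layer_body_def)
  then show "layer_ratio K f x \<le> l" using mem_layer_iff[OF K f] by simp
qed

text \<open>
  The constant \<open>C\<close> bounds the effect of \<open>K\<close> not being centred at the origin; it is the same for
  all directions \<open>v\<close>, which is the source of every uniformity below. The supremum over the
  functionals is replaced by the one functional at which the width ratio is attained.
\<close>
lemma gen_minkowski_approx: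
  fixes K :: "'a::real_normed_vector set"
  assumes K: "convex_body K"
  obtains C where
    "\<And>s v. s > 0 \<Longrightarrow> v \<noteq> 0 \<Longrightarrow> \<bar>gen_minkowski K (s *\<^sub>R v) / s - 2 / max_chord K v\<bar> \<le> C / s"
proof -
  obtain C where C0: "C \<ge> 0" and C: "\<And>f x. f \<in> sphere 0 1 \<Longrightarrow>
      \<bar>layer_ratio K f x - 2 * \<bar>blinfun_apply f x\<bar> / width_dir K f\<bar> \<le> C"
    using layer_ratio_approx[OF K] by blast
  show ?thesis
  proof
    fix s :: real and v :: 'a
    assume s: "s > 0" and v: "v \<noteq> 0"
    let ?b = "s * (2 / max_chord K v)" and ?\<alpha> = "gen_minkowski K (s *\<^sub>R v)"
    have ratio: "\<bar>layer_ratio K f (s *\<^sub>R v) - s * (2 * \<bar>blinfun_apply f v\<bar> / width_dir K f)\<bar> \<le> C"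
      if "f \<in> sphere 0 1" for f
      using C[OF that, of "s *\<^sub>R v"] s by (simp add: blinfun.scaleR_right abs_mult mult.left_commute)
    have upper: "layer_ratio K f (s *\<^sub>R v) \<le> ?b + C" if "f \<in> sphere 0 1" for f
      using ratio[OF that] mult_left_mono[OF width_ratio_le[OF K v that], of s] s by linarith
    have b: "0 \<le> ?b + C" using s C0 max_chord_pos[OF K v] by simp
    obtain f :: "'a \<Rightarrow>\<^sub>L real"
      where f: "f \<in> sphere 0 1" "2 * \<bar>f v\<bar> / width_dir K f = 2 / max_chord K v"
      using width_ratio_attained[OF K v] .
    have "?b - C \<le> layer_ratio K f (s *\<^sub>R v)"
      using ratio[OF f(1)] unfolding f(2) by linarith
    also have "\<dots> \<le> ?\<alpha>"
      by (rule layer_ratio_le_gen_minkowski[OF K f(1) b upper])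
    finally have "?b - C \<le> ?\<alpha>" .
    moreover have "?\<alpha> \<le> ?b + C"
      by (rule gen_minkowski_least[OF K b upper])
    ultimately have "\<bar>?\<alpha> - ?b\<bar> \<le> C" by linarith
    then have "\<bar>?\<alpha> - ?b\<bar> / s \<le> C / s" using s by (intro divide_right_mono) auto
    moreover have "?\<alpha> / s - 2 / max_chord K v = (?\<alpha> - ?b) / s"
      unfolding diff_divide_distrib using s by simp
    ultimately show "\<bar>?\<alpha> / s - 2 / max_chord K v\<bar> \<le> C / s"
      using s by (simp only: abs_divide abs_of_pos)
  qed
qed

section \<open>Extreme values of the maximal chord\<close>

lemma diameter_pos:
  fixes K :: "'a::real_normed_vector set"
  assumes K: "convex_body K" and v: "v \<noteq> (0::'a)"
  shows "diameter K > 0"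
proof -
  have "max_chord K v \<le> diameter K / norm v"
    using chord_le_diameter[OF K] v
    by (intro max_chord_least[OF K]) (auto simp: field_simps)
  with max_chord_pos[OF K v] have "0 < diameter K / norm v" by linarith
  then show ?thesis using v by (simp add: zero_less_divide_iff)
qed

lemma max_chord_le_diameter:
  assumes "convex_body K" "norm v = 1"
  shows "max_chord K v \<le> diameter K"
proof (rule max_chord_least[OF assms(1)])
  show "l \<le> diameter K" if "y \<in> K" "y + l *\<^sub>R v \<in> K" "0 \<le> l" for y l
    using chord_le_diameter[OF assms(1) that] assms(2) by simp
qed

lemma max_chord_approaches_diameter:
  assumes K: "convex_body K" and e: "0 \<le> e" "e < diameter K"
  obtains v where "norm v = 1" "e < max_chord K v"
proof -
  have "\<exists>y\<in>K. \<exists>z\<in>K. e < dist y z"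
  proof (rule ccontr)
    assume "\<not> ?thesis"
    then have "diameter K \<le> e"
      using e(1) by (intro diameter_le) (auto simp: dist_norm not_less)
    with e(2) show False by simp
  qed
  then obtain y z where yz: "y \<in> K" "z \<in> K" "e < dist y z" by blast
  then have ne: "z \<noteq> y" using e by auto
  have nz: "sgn (z - y) \<noteq> 0" using ne by (simp add: sgn_zero_iff)
  have "norm (z - y) *\<^sub>R sgn (z - y) = z - y" using ne by (simp add: sgn_div_norm)
  then have "norm (z - y) \<le> max_chord K (sgn (z - y))"
    using yz by (intro chord_le_max_chord[OF K nz, of y]) auto
  with yz(3) that[of "sgn (z - y)"] ne show ?thesis
    by (simp add: dist_norm norm_sgn norm_minus_commute)
qed

lemma min_width_lower:
  assumes "convex_body K" "f \<in> sphere 0 1"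
  shows "min_width K \<le> width_dir K f"
  unfolding min_width_def using assms width_dir_pos
  by (intro cINF_lower bdd_belowI2[where m = 0]) (auto intro: less_imp_le)

lemma min_width_pos:
  fixes K :: "'a::real_normed_vector set"
  assumes K: "convex_body K" and v: "v \<noteq> (0::'a)"
  shows "min_width K > 0"
proof -
  obtain c \<rho> where \<rho>: "\<rho> > 0" "cball c \<rho> \<subseteq> K" using convex_body_cball[OF K] .
  have "2 * \<rho> \<le> width_dir K f" if "f \<in> sphere 0 1" for f
    using norm_le_width_dir[OF K \<rho>, of f] that by simp
  then have "2 * \<rho> \<le> min_width K"
    unfolding min_width_def using dual_sphere_nonempty[OF K v] by (intro cINF_greatest)
  with \<rho> show ?thesis by linarith
qed

text \<open>
  The functional attaining the maximal chord has \<open>\<bar>f v\<bar> \<le> 1\<close>, so its width is at most that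
  chord.
\<close>
lemma min_width_le_max_chord:
  fixes v :: "'a::real_normed_vector"
  assumes K: "convex_body K" and v: "norm v = 1"
  shows "min_width K \<le> max_chord K v"
proof -
  have nz: "v \<noteq> 0" using v by auto
  obtain f :: "'a \<Rightarrow>\<^sub>L real"
    where f: "f \<in> sphere 0 1" "width_dir K f \<le> max_chord K v * \<bar>f v\<bar>"
    using width_dir_attains_max_chord[OF K nz] .
  have "\<bar>f v\<bar> \<le> 1" using norm_blinfun[of f v] f(1) v by simp
  then have "max_chord K v * \<bar>f v\<bar> \<le> max_chord K v * 1"
    using max_chord_pos[OF K nz] by (intro mult_left_mono) auto
  with f(2) min_width_lower[OF K f(1)] show ?thesis by simp
qed

text \<open>
  A unit functional \<open>f\<close> with \<open>width_dir K f < e\<close> has values greater than \<open>width_dir K f / e < 1\<close>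
  on some unit vectors, and the chords in such a direction are at most \<open>width_dir K f / \<bar>f v\<bar> < e\<close>.
\<close>
lemma max_chord_approaches_min_width:
  fixes K :: "'a::real_normed_vector set"
  assumes K: "convex_body K" and nontrivial: "u \<noteq> (0::'a)" and e: "min_width K < e"
  obtains v where "norm v = 1" "max_chord K v < e"
proof -
  have "\<exists>f\<in>sphere 0 1. width_dir K f < e"
  proof (rule ccontr)
    assume "\<not> ?thesis"
    then have "e \<le> min_width K"
      unfolding min_width_def using dual_sphere_nonempty[OF K nontrivial]
      by (intro cINF_greatest) (auto simp: not_less)
    with e show False by simp
  qed
  then obtain f :: "'a \<Rightarrow>\<^sub>L real" where f: "f \<in> sphere 0 1" "width_dir K f < e" by blast
  have w: "0 < width_dir K f" using width_dir_pos[OF K f(1)] .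
  have "\<exists>x. width_dir K f / e * norm x < \<bar>f x\<bar>"
  proof (rule ccontr)
    assume "\<not> ?thesis"
    then have "norm f \<le> width_dir K f / e"
      using w f(2) by (intro norm_blinfun_bound) (auto simp: not_less)
    then show False using w f by (simp add: field_simps)
  qed
  then obtain x where x: "width_dir K f / e * norm x < \<bar>f x\<bar>" by blast
  then have x0: "x \<noteq> 0" by auto
  let ?v = "sgn x"
  have v: "norm ?v = 1" "?v \<noteq> 0" using x0 by (auto simp: norm_sgn sgn_zero_iff)
  have "\<bar>f ?v\<bar> = \<bar>f x\<bar> / norm x"
    by (simp add: sgn_div_norm blinfun.scaleR_right abs_mult field_simps)
  moreover have "width_dir K f / e < \<bar>f x\<bar> / norm x"
    using x x0 by (simp add: pos_less_divide_eq)
  ultimately have "width_dir K f / e < \<bar>f ?v\<bar>" by simp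
  then have "max_chord K ?v * (width_dir K f / e) < max_chord K ?v * \<bar>f ?v\<bar>"
    using max_chord_pos[OF K v(2)] by (rule mult_strict_left_mono)
  also have "\<dots> \<le> width_dir K f" by (rule max_chord_mult_le_width_dir[OF K v(2)])
  finally have "max_chord K ?v < e" using w f(2) by (simp add: field_simps)
  with v(1) that show ?thesis by blast
qed

section \<open>Limits at infinity\<close>

text \<open>
  If \<open>F\<close> is radially asymptotic to \<open>g\<close> with an error uniform in the direction, large vectors
  near the infimum of \<open>g\<close> can be chosen direction first and length second, so the lower limit of
  \<open>F x / norm x\<close> is the infimum of \<open>g\<close> over the unit sphere, even if it is not attained.
\<close>
lemma Liminf_at_infinity_radial:
  fixes F g :: "'a::real_normed_vector \<Rightarrow> real"
  assumes approx: "\<And>s v. s > 0 \<Longrightarrow> norm v = 1 \<Longrightarrow> \<bar>F (s *\<^sub>R v) / s - g v\<bar> \<le> C / s"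
    and lower: "\<And>v. norm v = 1 \<Longrightarrow> m \<le> g v"
    and approached: "\<And>e. m < e \<Longrightarrow> \<exists>v. norm v = 1 \<and> g v < e"
  shows "Liminf at_infinity (\<lambda>x. ereal (F x / norm x)) = ereal m"
proof (rule antisym)
  show "ereal m \<le> Liminf at_infinity (\<lambda>x. ereal (F x / norm x))"
    unfolding le_Liminf_iff
  proof (intro allI impI)
    fix y
    assume "y < ereal m"
    then obtain e where e: "y < ereal e" "e < m" using ereal_dense2 by force
    have "e < F x / norm x" if x: "\<bar>C\<bar> / (m - e) + 1 \<le> norm x" for x
    proof -
      have "\<bar>C\<bar> / (m - e) \<ge> 0" using e by simp
      then have nx: "norm x > 0" using x by linarith
      have "\<bar>C\<bar> / (m - e) < norm x" using x by linarith
      then have "C / norm x < m - e" using e nx by (simp add: field_simps abs_if split: if_splits)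
      moreover have "m - C / norm x \<le> F x / norm x"
        using approx[of "norm x" "sgn x"] lower[of "sgn x"] nx
        by (simp add: norm_sgn sgn_div_norm)
      ultimately show ?thesis by linarith
    qed
    then have "eventually (\<lambda>x. e < F x / norm x) at_infinity"
      unfolding eventually_at_infinity by blast
    then show "eventually (\<lambda>x. y < ereal (F x / norm x)) at_infinity"
      by (rule eventually_mono) (use e in \<open>auto intro: less_trans\<close>)
  qed
next
  show "Liminf at_infinity (\<lambda>x. ereal (F x / norm x)) \<le> ereal m"
  proof (rule ccontr)
    assume "\<not> ?thesis"
    then have "ereal m < Liminf at_infinity (\<lambda>x. ereal (F x / norm x))" by (simp add: not_le)
    then obtain e where e: "m < e" "ereal e < Liminf at_infinity (\<lambda>x. ereal (F x / norm x))"
      using ereal_dense2 by force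
    then obtain b where b: "\<And>x. b \<le> norm x \<Longrightarrow> e < F x / norm x"
      using less_LiminfD[OF e(2)] by (auto simp: eventually_at_infinity)
    obtain v where v: "norm v = 1" "g v < e" using approached[OF e(1)] by blast
    define s where "s = \<bar>C\<bar> / (e - g v) + \<bar>b\<bar> + 1"
    have "\<bar>C\<bar> / (e - g v) \<ge> 0" using v by simp
    then have s: "s > 0" "s \<ge> b" "s > \<bar>C\<bar> / (e - g v)" by (auto simp: s_def)
    then have "C / s < e - g v" using v by (simp add: field_simps abs_if split: if_splits)
    then have "F (s *\<^sub>R v) / s < e" using approx[OF s(1) v(1)] by linarith
    with b[of "s *\<^sub>R v"] s v show False by simp
  qed
qed

lemma Limsup_at_infinity_radial:
  fixes F g :: "'a::real_normed_vector \<Rightarrow> real"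
  assumes approx: "\<And>s v. s > 0 \<Longrightarrow> norm v = 1 \<Longrightarrow> \<bar>F (s *\<^sub>R v) / s - g v\<bar> \<le> C / s"
    and upper: "\<And>v. norm v = 1 \<Longrightarrow> g v \<le> m"
    and approached: "\<And>e. e < m \<Longrightarrow> \<exists>v. norm v = 1 \<and> e < g v"
  shows "Limsup at_infinity (\<lambda>x. ereal (F x / norm x)) = ereal m"
proof -
  have "Liminf at_infinity (\<lambda>x. ereal (- F x / norm x)) = ereal (- m)"
  proof (rule Liminf_at_infinity_radial[where g = "\<lambda>v. - g v" and C = C])
    show "\<bar>- F (s *\<^sub>R v) / s - - g v\<bar> \<le> C / s" if "s > 0" "norm v = 1" for s v
      using approx[OF that] by (simp add: abs_le_iff)
    show "\<exists>v. norm v = 1 \<and> - g v < e" if "- m < e" for e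
      using approached[of "- e"] that by (auto simp: minus_less_iff)
  qed (use upper in auto)
  moreover have "Liminf at_infinity (\<lambda>x. ereal (- F x / norm x))
      = - Limsup at_infinity (\<lambda>x. ereal (F x / norm x))"
    by (simp flip: ereal_Liminf_uminus)
  ultimately have "- Limsup at_infinity (\<lambda>x. ereal (F x / norm x)) = - ereal m" by simp
  then show ?thesis by (simp only: ereal_uminus_eq_iff)
qed

lemma uniform_limit_radial:
  fixes F g :: "'a::real_normed_vector \<Rightarrow> real"
  assumes approx: "\<And>s v. s > 0 \<Longrightarrow> norm v = 1 \<Longrightarrow> \<bar>F (s *\<^sub>R v) / s - g v\<bar> \<le> C / s"
  shows "uniform_limit (sphere 0 1) (\<lambda>s v. F (s *\<^sub>R v) / s) g at_top"
proof (rule uniform_limitI)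
  fix e :: real
  assume e: "e > 0"
  have "((\<lambda>s. C / s) \<longlongrightarrow> 0) at_top"
    by (intro tendsto_divide_0[OF tendsto_const] filterlim_at_top_imp_at_infinity filterlim_ident)
  then have "eventually (\<lambda>s. C / s < e) at_top" using e by (rule order_tendstoD)
  then show "eventually (\<lambda>s. \<forall>v\<in>sphere 0 1. dist (F (s *\<^sub>R v) / s) (g v) < e) at_top"
    using eventually_gt_at_top[of 0]
    by eventually_elim (use approx in \<open>force simp: dist_real_def intro: le_less_trans\<close>)
qed

lemma bigtheta_radial:
  fixes F g :: "'a::real_normed_vector \<Rightarrow> real"
  assumes approx: "\<And>s v. s > 0 \<Longrightarrow> norm v = 1 \<Longrightarrow> \<bar>F (s *\<^sub>R v) / s - g v\<bar> \<le> C / s"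
    and bounds: "0 < a" "\<And>v. norm v = 1 \<Longrightarrow> a \<le> g v" "\<And>v. norm v = 1 \<Longrightarrow> g v \<le> b"
  shows "F \<in> \<Theta>[at_infinity](\<lambda>x. norm x)"
proof (rule bigthetaI')
  have close: "\<bar>F x / norm x - g (sgn x)\<bar> < a / 2 \<and> norm x > 0 \<and> norm (sgn x) = 1"
    if x: "2 * \<bar>C\<bar> / a + 1 \<le> norm x" for x
  proof -
    have "2 * \<bar>C\<bar> / a \<ge> 0" using bounds(1) by simp
    then have nx: "norm x > 0" using x by linarith
    have "2 * \<bar>C\<bar> / a < norm x" using x by linarith
    then have "C / norm x < a / 2"
      using bounds(1) nx by (simp add: field_simps abs_if split: if_splits)
    moreover have "\<bar>F x / norm x - g (sgn x)\<bar> \<le> C / norm x"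
      using approx[of "norm x" "sgn x"] nx by (simp add: norm_sgn sgn_div_norm)
    ultimately show ?thesis using nx by (auto simp only: norm_sgn) auto
  qed
  have "norm (F x) \<ge> a / 2 * norm (norm x) \<and> norm (F x) \<le> (\<bar>b\<bar> + a) * norm (norm x)"
    if x: "2 * \<bar>C\<bar> / a + 1 \<le> norm x" for x
  proof -
    have *: "\<bar>F x / norm x - g (sgn x)\<bar> < a / 2" "norm x > 0" "norm (sgn x) = 1"
      using close[OF x] by auto
    have "a / 2 \<le> F x / norm x" "F x / norm x \<le> \<bar>b\<bar> + a"
      using *(1) bounds(1) bounds(2,3)[OF *(3)] by linarith+
    then have le: "a / 2 * norm x \<le> F x" "F x \<le> (\<bar>b\<bar> + a) * norm x"
      using *(2) by (simp_all add: pos_le_divide_eq pos_divide_le_eq)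
    have "0 \<le> a / 2 * norm x" using bounds(1) by simp
    with le(1) have "0 \<le> F x" by linarith
    with le show ?thesis by simp
  qed
  then show "eventually (\<lambda>x. norm (F x) \<ge> a / 2 * norm (norm x)
      \<and> norm (F x) \<le> (\<bar>b\<bar> + a) * norm (norm x)) at_infinity"
    unfolding eventually_at_infinity by blast
qed (use bounds in auto)

section \<open>Asymptotics of the generalized Minkowski functional\<close>

theorem corollary5p8:
  fixes K :: "'a::real_normed_vector set"
  assumes "(UNIV :: 'a set) \<noteq> {0}"
    and "convex_body K"
  shows "gen_minkowski K \<in> \<Theta>[at_infinity](\<lambda>x. norm x)
    \<and> uniform_limit (sphere 0 1) (\<lambda>s v. gen_minkowski K (s *\<^sub>R v) / s)
          (\<lambda>v. 2 / max_chord K v) at_top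
    \<and> ereal (2 / diameter K) = Liminf at_infinity (\<lambda>x. ereal (gen_minkowski K x / norm x))
    \<and> Liminf at_infinity (\<lambda>x. ereal (gen_minkowski K x / norm x))
        \<le> Limsup at_infinity (\<lambda>x. ereal (gen_minkowski K x / norm x))
    \<and> Limsup at_infinity (\<lambda>x. ereal (gen_minkowski K x / norm x)) = ereal (2 / min_width K)"
proof -
  note K = assms(2)
  obtain u :: 'a where u: "u \<noteq> 0" using assms(1) by auto
  let ?g = "\<lambda>v. 2 / max_chord K v"
  note d = diameter_pos[OF K u] and w = min_width_pos[OF K u]
  obtain C where "\<And>s v. s > 0 \<Longrightarrow> v \<noteq> 0 \<Longrightarrow> \<bar>gen_minkowski K (s *\<^sub>R v) / s - ?g v\<bar> \<le> C / s"
    using gen_minkowski_approx[OF K] by blast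
  then have approx: "\<bar>gen_minkowski K (s *\<^sub>R v) / s - ?g v\<bar> \<le> C / s" if "s > 0" "norm v = 1" for s v
    using that by (metis norm_zero zero_neq_one)
  have chord: "max_chord K v > 0" if "norm v = 1" for v
    using max_chord_pos[OF K, of v] that by (metis norm_zero zero_neq_one)
  have lower: "2 / diameter K \<le> ?g v" if "norm v = 1" for v
    using max_chord_le_diameter[OF K that] chord[OF that] by (simp add: frac_le)
  have upper: "?g v \<le> 2 / min_width K" if "norm v = 1" for v
    using min_width_le_max_chord[OF K that] w by (simp add: frac_le)
  have liminf: "Liminf at_infinity (\<lambda>x. ereal (gen_minkowski K x / norm x)) = ereal (2 / diameter K)"
  proof (rule Liminf_at_infinity_radial[OF approx lower])
    fix e
    assume e: "2 / diameter K < e"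
    have e0: "e > 0" using e d by (metis divide_pos_pos less_trans zero_less_numeral)
    then have "0 \<le> 2 / e" "2 / e < diameter K" using e d by (auto simp: field_simps)
    then obtain v where v: "norm v = 1" "2 / e < max_chord K v"
      using max_chord_approaches_diameter[OF K] by blast
    then show "\<exists>v. norm v = 1 \<and> ?g v < e" using e0 chord by (auto simp: field_simps)
  qed
  have limsup: "Limsup at_infinity (\<lambda>x. ereal (gen_minkowski K x / norm x)) = ereal (2 / min_width K)"
  proof (rule Limsup_at_infinity_radial[OF approx upper])
    fix e
    assume e: "e < 2 / min_width K"
    \<comment> \<open>As \<open>e\<close> may be nonpositive, it is raised to a positive bound, whose reciprocal
        is comparable with a chord length.\<close>
    define e' where "e' = max e (1 / min_width K)"
    have e': "e \<le> e'" "0 < e'" "e' < 2 / min_width K"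
      using e w by (auto simp: e'_def less_max_iff_disj divide_strict_right_mono)
    then have "min_width K < 2 / e'" using w by (simp add: field_simps)
    then obtain v where v: "norm v = 1" "max_chord K v < 2 / e'"
      using max_chord_approaches_min_width[OF K u] by blast
    then have "e' < ?g v" using e'(2) chord by (simp add: field_simps)
    with v(1) e'(1) show "\<exists>v. norm v = 1 \<and> e < ?g v" by force
  qed
  have "2 / diameter K \<le> 2 / min_width K"
  proof -
    have "norm (sgn u) = 1" using u by (simp add: norm_sgn)
    with lower upper show ?thesis by (meson order_trans)
  qed
  moreover have "gen_minkowski K \<in> \<Theta>[at_infinity](\<lambda>x. norm x)"
    using d by (intro bigtheta_radial[OF approx _ lower upper]) auto
  ultimately show ?thesis
    using uniform_limit_radial[OF approx] liminf limsup by simp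
qed

end
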